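(* Let $x^*\in\{0,\pm1\}^d$, $S:=\operatorname{supp}(x^* )$, and assume $|S|=\sigma$. Define $y^*:=-M^\top b/n$ and $Y_{11}^*:=-(y_S^* )^\top x_S^*$, and assume $Y_{11}^*>0$. Let $\theta:=\arccos\Big(\frac{(y_S^* )^\top x_S^*}{\sqrt\sigma\|y_S^*\|_2}\Big)$. For $\delta>0$ let $$\Delta_1:=\min_{i\in S}(-y_i^*/x_i^* )-\|y_{S^c}^*\|_\infty,\qquad \Delta_2:=\min_{i\in S}(-y_i^*/x_i^* )-\Big\{\frac{\sigma\|y_{S^c}^*\|_\infty^2}{Y_{11}^*}+\frac{1-\cos^2(\theta)}{\delta\cos^2(\theta)}\|y_{S^c}^*\|_\infty^2\Big\},$$ and assume that the columns $M_1,\dots,M_d$ of $M$ are normalized such that $\max_{i}\|M_i\|_2\le1$. Then (SILS'-SDP) recovers $x^*$ if there exists a constant $\delta>0$ such that the following conditions are satisfied: (C1) $\lambda_{\min}\big(\frac1n(M^\top M)_{S,S}\big)-\delta-\big\|\frac1n(M^\top M)_{S,S}x_S^*\big\|_\infty+\min_{j=1,2}\Delta_j\ge\Delta>0$ for some constant $\Delta$; (C2) there exists $\mu_2^*\le-\lambda_{\min}\big(\frac1n(M^\top M)_{S,S}\big)+\delta$ such that $\big\|\operatorname{diag}\big(M^\top M/n+\mu_2^*I_d\big)_{S^c}\big\|_\infty<\Delta/\sigma$; (C3) $\mu(M^\top M)<\Delta/\sigma$.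
   Context: $n,d,\sigma$ are positive integers with $\sigma\le d$, $M\in\mathbb{R}^{n\times d}$, $b\in\mathbb{R}^n$, and $A:=\begin{pmatrix}-b&M\end{pmatrix}\in\mathbb{R}^{n\times(1+d)}$. The coherence of a positive semidefinite matrix $\Psi$ is $\mu(\Psi):=\max_{i\ne j}\frac{|\Psi_{ij}|}{\sqrt{|\Psi_{ii}\Psi_{jj}|}}$, with the convention $0/0=0$. (SILS'-SDP): minimize $\frac1n\operatorname{tr}(A^\top AW)$ over symmetric positive semidefinite $W\in\mathbb{R}^{(1+d)\times(1+d)}$ subject to $W_{11}=1$, $\operatorname{tr}(W_x)=\sigma$, $1_d^\top|W_x|1_d\le\sigma^2$, $\operatorname{diag}(W_x)\le1_d$ (entrywise), where $W_x$ is $W$ with first row and column deleted, $|W_x|$ is the entrywise absolute value, and $1_d$ is the all-ones vector. It is a relaxation of (SILS'): minimize $\frac1n\|Mx-b\|_2^2$ over $x\in\{0,\pm1\}^d$ with exactly $\sigma$ nonzero entries. "(SILS'-SDP) recovers $x^*$" means: $x^*\in\{0,\pm1\}^d$ and (SILS'-SDP) has a unique optimal solution, namely the rank-one matrix $W^*=\begin{pmatrix}1 \\ x^*\end{pmatrix}\begin{pmatrix}1 \\ x^*\end{pmatrix}^\top$. Notation: $\operatorname{supp}(x)=\{i:x_i\ne0\}$; $S^c=\{1,\dots,d\}\setminus S$; $v_I$ and $N_{I,J}$ denote the subvector and submatrix with the indicated indices; $\operatorname{diag}(N)$ of a matrix is the vector of its diagonal entries; $\|\cdot\|_\infty$ is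 the largest absolute value of an entry of a vector or matrix ($0$ for an empty one); $\lambda_{\min}$ is the smallest eigenvalue. *)

theory Defs
  imports "HOL-Analysis.Analysis"
begin

subsection \<open>Vectors and matrices\<close>

definition supp :: "real^'d \<Rightarrow> 'd set" where
  "supp x = {i. x $ i \<noteq> 0}"

text \<open>Largest absolute value of the family \<open>f\<close> over the index set \<open>I\<close>;
  inserting \<open>0\<close> gives the value \<open>0\<close> for an empty index set and changes nothing otherwise.\<close>

definition linf_on :: "'i set \<Rightarrow> ('i \<Rightarrow> real) \<Rightarrow> real" where
  "linf_on I f = Max (insert 0 ((\<lambda>i. \<bar>f i\<bar>) ` I))"

text \<open>The principal submatrix of \<open>N\<close> with rows and columns in \<open>I\<close> acts on the restrictions
  of vectors to \<open>I\<close>: the entries of \<open>v\<close> outside \<open>I\<close> are irrelevant below.\<close>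

definition eigenvalue_on :: "'d::finite set \<Rightarrow> real^'d^'d \<Rightarrow> real \<Rightarrow> bool" where
  "eigenvalue_on I N l \<longleftrightarrow>
    (\<exists>v :: real^'d. (\<exists>i\<in>I. v $ i \<noteq> 0) \<and> (\<forall>i\<in>I. (\<Sum>j\<in>I. N $ i $ j * v $ j) = l * v $ i))"

definition lambda_min_on :: "'d::finite set \<Rightarrow> real^'d^'d \<Rightarrow> real" where
  "lambda_min_on I N = (LEAST l. eigenvalue_on I N l)"

definition psd :: "real^'k^'k \<Rightarrow> bool" where
  "psd N \<longleftrightarrow> transpose N = N \<and> (\<forall>v. 0 \<le> v \<bullet> (N *v v))"

text \<open>The convention \<open>0/0 = 0\<close> is that of HOL division. For a \<open>1 \<times> 1\<close> matrix
  there are no off-diagonal entries and the coherence is \<open>0\<close>.\<close>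

definition coherence :: "real^'d^'d \<Rightarrow> real" where
  "coherence N = Max (insert 0 {\<bar>N $ i $ j\<bar> / sqrt \<bar>N $ i $ i * N $ j $ j\<bar> | i j. i \<noteq> j})"

definition gram :: "real^'d^'n \<Rightarrow> real^'d^'d" where
  "gram M = (1 / real CARD('n)) *\<^sub>R (transpose M ** M)"

subsection \<open>The semidefinite relaxation\<close>

text \<open>A \<open>(1+d)\<close>-dimensional index set is rendered by the type \<open>'d option\<close>, where
  \<open>None\<close> is the first index.\<close>

definition augmented :: "real^'d^'n \<Rightarrow> real^'n \<Rightarrow> real^('d::finite option)^'n" where
  "augmented M b = (\<chi> k j. case j of None \<Rightarrow> - b $ k | Some i \<Rightarrow> M $ k $ i)"

definition x_block :: "real^('d::finite option)^('d::finite option) \<Rightarrow> real^'d^'d" where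
  "x_block W = (\<chi> i j. W $ Some i $ Some j)"

definition sdp_objective ::
  "real^'d^'n \<Rightarrow> real^'n \<Rightarrow> real^('d::finite option)^('d::finite option) \<Rightarrow> real" where
  "sdp_objective M b W =
    (1 / real CARD('n)) * trace (transpose (augmented M b) ** augmented M b ** W)"

definition sdp_feasible :: "nat \<Rightarrow> real^('d::finite option)^('d::finite option) \<Rightarrow> bool" where
  "sdp_feasible \<sigma> W \<longleftrightarrow>
    psd W \<and> W $ None $ None = 1 \<and> trace (x_block W) = real \<sigma> \<and>
    (\<Sum>i\<in>UNIV. \<Sum>j\<in>UNIV. \<bar>x_block W $ i $ j\<bar>) \<le> (real \<sigma>)\<^sup>2 \<and>
    (\<forall>i. x_block W $ i $ i \<le> 1)"

definition sdp_optimal ::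
  "nat \<Rightarrow> real^'d^'n \<Rightarrow> real^'n \<Rightarrow> real^('d::finite option)^('d::finite option) \<Rightarrow> bool" where
  "sdp_optimal \<sigma> M b W \<longleftrightarrow>
    sdp_feasible \<sigma> W \<and> (\<forall>V. sdp_feasible \<sigma> V \<longrightarrow> sdp_objective M b W \<le> sdp_objective M b V)"

definition lift_vec :: "real^'d \<Rightarrow> real^('d::finite option)" where
  "lift_vec x = (\<chi> i. case i of None \<Rightarrow> 1 | Some k \<Rightarrow> x $ k)"

definition rank_one_lift :: "real^'d \<Rightarrow> real^('d::finite option)^('d::finite option)" where
  "rank_one_lift x = (\<chi> i j. lift_vec x $ i * lift_vec x $ j)"

definition sdp_recovers :: "nat \<Rightarrow> real^'d^'n \<Rightarrow> real^'n \<Rightarrow> real^'d \<Rightarrow> bool" where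
  "sdp_recovers \<sigma> M b x \<longleftrightarrow>
    (\<forall>i. x $ i \<in> {0, 1, -1}) \<and> (\<forall>W. sdp_optimal \<sigma> M b W \<longleftrightarrow> W = rank_one_lift x)"

subsection \<open>Quantities attached to a signed binary vector\<close>

definition y_star :: "real^'d^'n \<Rightarrow> real^'n \<Rightarrow> real^'d" where
  "y_star M b = - ((1 / real CARD('n)) *\<^sub>R (transpose M *v b))"

definition Y11_star :: "real^'d^'n \<Rightarrow> real^'n \<Rightarrow> real^'d \<Rightarrow> real" where
  "Y11_star M b x = - (\<Sum>i\<in>supp x. y_star M b $ i * x $ i)"

definition theta :: "nat \<Rightarrow> real^'d^'n \<Rightarrow> real^'n \<Rightarrow> real^'d \<Rightarrow> real" where
  "theta \<sigma> M b x =
    arccos ((\<Sum>i\<in>supp x. y_star M b $ i * x $ i) /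
            (sqrt (real \<sigma>) * L2_set (\<lambda>i. y_star M b $ i) (supp x)))"

definition Delta1 :: "real^'d^'n \<Rightarrow> real^'n \<Rightarrow> real^'d \<Rightarrow> real" where
  "Delta1 M b x =
    Min ((\<lambda>i. - y_star M b $ i / x $ i) ` supp x) - linf_on (- supp x) (\<lambda>i. y_star M b $ i)"

definition Delta2 :: "nat \<Rightarrow> real^'d^'n \<Rightarrow> real^'n \<Rightarrow> real^'d \<Rightarrow> real \<Rightarrow> real" where
  "Delta2 \<sigma> M b x \<delta> =
    Min ((\<lambda>i. - y_star M b $ i / x $ i) ` supp x) -
    (real \<sigma> * (linf_on (- supp x) (\<lambda>i. y_star M b $ i))\<^sup>2 / Y11_star M b x +
     (1 - (cos (theta \<sigma> M b x))\<^sup>2) / (\<delta> * (cos (theta \<sigma> M b x))\<^sup>2) *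
       (linf_on (- supp x) (\<lambda>i. y_star M b $ i))\<^sup>2)"

end

theory Submission
  imports Defs
begin

text \<open>Write \<open>G = M\<^sup>TM/n\<close> and \<open>S\<close> for the support of \<open>x\<close>. Optimality is certified by SDP duality: one
  exhibits \<open>Z = G + \<mu> I + diag p + K U\<close> with \<open>p \<ge> 0\<close> supported on \<open>S\<close>, \<open>\<bar>U i j\<bar> \<le> 1\<close> and
  \<open>U = x x\<^sup>T\<close> on \<open>S \<times> S\<close>, such that the matrix \<open>Y\<close> with rows \<open>(Y11, y\<^sup>T)\<close> and \<open>(y, Z)\<close> is
  positive semidefinite and annihilates \<open>(1, x)\<close>. On \<open>S\<close> the vector \<open>p\<close> is forced by the kernel
  condition; off \<open>S\<close> the freedom in \<open>U\<close> allows one to choose the block \<open>- y x\<^sup>T / \<sigma>\<close> and the block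
  \<open>t y y\<^sup>T\<close>, so that semidefiniteness only needs \<open>Z \<ge> \<delta> I\<close> on \<open>S\<close> and a square completion.
  The coherence and diagonal conditions give \<open>\<bar>U i j\<bar> < 1\<close> off \<open>S \<times> S\<close>, so the \<open>x\<close>-block of an
  optimal solution vanishes there. The trace and absolute-sum constraints then determine this
  block, and the objective value determines the remaining column because \<open>Y11 > 0\<close>.\<close>

section \<open>Positive semidefinite forms and the pairing of two of them\<close>

lemma matrix_entry_inner: "(N::real^'k^'k) $ i $ j = axis i 1 \<bullet> (N *v axis j 1)"
  by (simp add: inner_axis' matrix_vector_mul_component column_def inner_axis)

lemma symmetric_matrix_inner:
  fixes N :: "real^'k^'k"
  assumes "transpose N = N"
  shows "u \<bullet> (N *v v) = v \<bullet> (N *v u)"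
  by (metis assms dot_lmul_matrix inner_commute transpose_matrix_vector)

lemma sym_entry: "transpose N = N \<Longrightarrow> N $ i $ j = N $ j $ i"
  by (metis transpose_def vec_lambda_beta)

lemma psd_quadratic:
  fixes N :: "real^'k^'k"
  assumes "psd N"
  shows "0 \<le> u \<bullet> (N *v u) - 2 * c * (v \<bullet> (N *v u)) + c\<^sup>2 * (v \<bullet> (N *v v))"
proof -
  have "0 \<le> (u - c *\<^sub>R v) \<bullet> (N *v (u - c *\<^sub>R v))"
    using assms by (simp only: psd_def)
  also have "\<dots> = u \<bullet> (N *v u) - 2 * c * (v \<bullet> (N *v u)) + c\<^sup>2 * (v \<bullet> (N *v v))"
    using assms symmetric_matrix_inner[of N u v]
    by (simp add: psd_def matrix_vector_mult_diff_distrib inner_diff_left inner_diff_right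
        matrix_vector_mult_scaleR power2_eq_square algebra_simps)
  finally show ?thesis .
qed

lemma psd_diag_nonneg: "psd N \<Longrightarrow> 0 \<le> N $ i $ i"
  by (simp add: psd_def matrix_entry_inner)

text \<open>For \<open>r > 0\<close> evaluate at the minimiser \<open>c = q / r\<close>. For
  \<open>r = 0\<close> the expression is affine in \<open>c\<close> and bounded below only if
  \<open>q = 0\<close>.\<close>

lemma quadratic_nonneg_imp_discriminant:
  fixes p q r :: real
  assumes nonneg: "\<And>c. 0 \<le> p - 2 * c * q + c\<^sup>2 * r" and "0 \<le> r"
  shows "q\<^sup>2 \<le> p * r"
proof (cases "r = 0")
  case True
  have "q = 0"
  proof (rule ccontr)
    assume "q \<noteq> 0"
    \<comment> \<open>At this \<open>c\<close> the affine expression equals -1.\<close>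
    then show False
      using nonneg[of "(p + 1) / (2 * q)"] True by (simp add: field_simps)
  qed
  then show ?thesis using True by simp
next
  case False
  with \<open>0 \<le> r\<close> have "0 < r" by simp
  then have "0 \<le> r * (p - 2 * (q / r) * q + (q / r)\<^sup>2 * r)"
    using nonneg[of "q / r"] by (intro mult_nonneg_nonneg) auto
  also have "\<dots> = p * r - q\<^sup>2"
    using \<open>0 < r\<close> by (simp add: power2_eq_square field_simps)
  finally show ?thesis by simp
qed

lemma psd_cauchy_schwarz:
  "psd N \<Longrightarrow> (v \<bullet> (N *v u))\<^sup>2 \<le> (u \<bullet> (N *v u)) * (v \<bullet> (N *v v))"
  by (rule quadratic_nonneg_imp_discriminant[OF psd_quadratic]) (simp_all add: psd_def)

lemma psd_entry_bound:
  assumes "psd N"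
  shows "(N $ i $ j)\<^sup>2 \<le> N $ i $ i * N $ j $ j"
  using psd_cauchy_schwarz[OF assms, of "axis i 1" "axis j 1"]
  by (simp add: matrix_entry_inner mult.commute)

text \<open>Eliminating one diagonal pivot of \<open>W\<close> at a time (Cholesky) writes \<open>W\<close> as a sum of rank-one
  matrices and avoids the spectral theorem.\<close>

lemma psd_pairing_nonneg_aux:
  fixes Y W :: "real^'k^'k"
  assumes Y: "\<And>v. 0 \<le> v \<bullet> (Y *v v)"
  shows "finite I \<Longrightarrow> psd W \<Longrightarrow> (\<And>i. i \<notin> I \<Longrightarrow> W $ i $ i = 0)
    \<Longrightarrow> 0 \<le> (\<Sum>i\<in>UNIV. \<Sum>j\<in>UNIV. Y $ i $ j * W $ i $ j)"
proof (induction I arbitrary: W rule: finite_induct)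
  case empty
  \<comment> \<open>With \<open>I\<close> empty the diagonal vanishes, and the 2 x 2 minors then
    kill every entry.\<close>
  have "W $ i $ j = 0" for i j
    using psd_entry_bound[OF empty(1), of i j] empty(2) by simp
  then show ?case by simp
next
  case (insert k I)
  show ?case
  proof (cases "W $ k $ k = 0")
    case True
    then have "W $ i $ i = 0" if "i \<notin> I" for i
      using that insert.prems(2)[of i] by (cases "i = k") auto
    then show ?thesis by (rule insert.IH[OF insert.prems(1)])
  next
    case False
    define c where "c = W $ k $ k"
    have c: "0 < c"
      using False psd_diag_nonneg[OF insert.prems(1), of k] by (simp add: c_def)
    have sym: "W $ i $ j = W $ j $ i" for i j
      using insert.prems(1) sym_entry by (auto simp: psd_def)
    \<comment> \<open>The Schur complement of the pivot \<open>k\<close>, bordered by a zero row and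
      column. Passing from \<open>W\<close> to \<open>V\<close> lowers the form at \<open>v\<close>
      by \<open>r * r / c\<close>, which Cauchy-Schwarz against \<open>axis k 1\<close>
      permits.\<close>
    define V where "V = (\<chi> i j. W $ i $ j - W $ i $ k * W $ j $ k / c)"
    have "0 \<le> v \<bullet> (V *v v)" for v
    proof -
      define r where "r = axis k 1 \<bullet> (W *v v)"
      have r: "r = (\<Sum>i\<in>UNIV. W $ i $ k * v $ i)"
        unfolding r_def by (simp add: inner_axis' matrix_vector_mult_def sym)
      have "v \<bullet> (V *v v) = v \<bullet> (W *v v) - r * r / c"
        unfolding r sum_product
        by (simp add: V_def inner_vec_def matrix_vector_mult_def left_diff_distrib
          right_diff_distrib sum_subtractf sum_divide_distrib sum_distrib_left mult_ac)
      moreover have "(r)\<^sup>2 \<le> (v \<bullet> (W *v v)) * c"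
        unfolding c_def r_def matrix_entry_inner by (rule psd_cauchy_schwarz[OF insert.prems(1)])
      then have "r * r / c \<le> v \<bullet> (W *v v)"
        using c by (simp add: pos_divide_le_eq power2_eq_square)
      ultimately show ?thesis by simp
    qed
    moreover have "transpose V = V"
      by (simp add: V_def transpose_def sym vec_eq_iff mult.commute)
    ultimately have "psd V" by (simp add: psd_def)
    \<comment> \<open>The pivot cancels its own diagonal entry. Earlier zeros survive because a zero
      diagonal entry forces a zero row.\<close>
    moreover have "V $ i $ i = 0" if "i \<notin> I" for i
    proof (cases "i = k")
      case True
      then show ?thesis using c by (simp add: V_def c_def)
    next
      case False
      then have "W $ i $ i = 0" using that insert.prems(2) by simp
      moreover have "W $ i $ k = 0"
        using psd_entry_bound[OF insert.prems(1), of i k] \<open>W $ i $ i = 0\<close> by simp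
      ultimately show ?thesis by (simp add: V_def)
    qed
    ultimately have V0: "0 \<le> (\<Sum>i\<in>UNIV. \<Sum>j\<in>UNIV. Y $ i $ j * V $ i $ j)"
      by (rule insert.IH)
    define u where "u = (\<chi> i. W $ i $ k)"
    have "(\<Sum>i\<in>UNIV. \<Sum>j\<in>UNIV. Y $ i $ j * W $ i $ j)
        = (\<Sum>i\<in>UNIV. \<Sum>j\<in>UNIV. Y $ i $ j * V $ i $ j + Y $ i $ j * (u $ i * u $ j) / c)"
      by (intro sum.cong refl) (simp add: V_def u_def algebra_simps)
    also have "\<dots> = (\<Sum>i\<in>UNIV. \<Sum>j\<in>UNIV. Y $ i $ j * V $ i $ j) + (u \<bullet> (Y *v u)) / c"
      by (simp add: sum.distrib inner_vec_def matrix_vector_mult_def sum_divide_distrib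
          sum_distrib_left mult_ac)
    finally show ?thesis using V0 Y c by (simp add: divide_nonneg_pos)
  qed
qed

lemma psd_pairing_nonneg:
  fixes Y W :: "real^'k^'k"
  assumes "\<And>v. 0 \<le> v \<bullet> (Y *v v)" and "psd W"
  shows "0 \<le> (\<Sum>i\<in>UNIV. \<Sum>j\<in>UNIV. Y $ i $ j * W $ i $ j)"
  using psd_pairing_nonneg_aux[of Y UNIV W] assms by simp

section \<open>The smallest eigenvalue of a principal submatrix\<close>

text \<open>The form attains a minimum \<open>m\<close> on the unit sphere of the vectors supported
  on \<open>S\<close>. A minimiser is an eigenvector for \<open>m\<close>, and no eigenvalue lies
  below \<open>m\<close>, so the \<open>LEAST\<close> in the definition exists and equals
  \<open>m\<close>.\<close>

lemma lambda_min_on_rayleigh: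
  fixes N :: "real^'d^'d" and v :: "real^'d"
  assumes sym: "transpose N = N" and "S \<noteq> {}"
    and v: "\<And>i. i \<notin> S \<Longrightarrow> v $ i = 0"
  shows "lambda_min_on S N * (v \<bullet> v) \<le> v \<bullet> (N *v v)"
proof -
  define V where "V = {v::real^'d. \<forall>i. i \<notin> S \<longrightarrow> v $ i = 0}"
  have VI: "w \<in> V" if "\<And>i. i \<notin> S \<Longrightarrow> w $ i = 0" for w using that by (simp add: V_def)
  define T where "T = V \<inter> sphere 0 1"
  have "closed V"
  proof -
    have "V = (\<Inter>i\<in>-S. {v. v $ i = 0})" by (auto simp: V_def)
    moreover have "closed {v::real^'d. v $ i = 0}" for i
      by (intro closed_Collect_eq continuous_intros)
    ultimately show ?thesis by (simp add: closed_INT)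
  qed
  then have T: "compact T" unfolding T_def by (intro closed_Int_compact) auto
  obtain k where "k \<in> S" using \<open>S \<noteq> {}\<close> by blast
  then have "axis k 1 \<in> T" by (auto simp: T_def V_def axis_def[of k 1, symmetric]) (auto simp: axis_def)
  then have "T \<noteq> {}" by blast
  have "continuous_on T (\<lambda>v. v \<bullet> (N *v v))"
    by (intro continuous_intros matrix_vector_mult_linear_continuous_on)
  from continuous_attains_inf[OF T \<open>T \<noteq> {}\<close> this]
  obtain w where w: "w \<in> T" and min: "\<And>u. u \<in> T \<Longrightarrow> w \<bullet> (N *v w) \<le> u \<bullet> (N *v u)"
    by auto
  define m where "m = w \<bullet> (N *v w)"
  have wV: "w \<in> V" and ww: "w \<bullet> w = 1" using w by (auto simp: T_def norm_eq_1)
  have ray: "m * (u \<bullet> u) \<le> u \<bullet> (N *v u)" if "u \<in> V" for u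
  proof (cases "u = 0")
    case False
    then have "(1 / norm u) *\<^sub>R u \<in> T" using that by (simp add: T_def V_def)
    from min[OF this] have "m \<le> u \<bullet> (N *v u) / (norm u)\<^sup>2"
      by (simp add: m_def matrix_vector_mult_scaleR power2_eq_square)
    then show ?thesis using False by (simp add: field_simps power2_norm_eq_inner)
  qed simp
  \<comment> \<open>Inserting \<open>w - c *\<^sub>R u\<close> into \<open>ray\<close> gives a
    nonnegative quadratic in \<open>c\<close> without constant term, so its linear coefficient
    \<open>g\<close> vanishes.\<close>
  have stat: "u \<bullet> (N *v w) = m * (u \<bullet> w)" if "u \<in> V" for u
  proof -
    define g where "g = u \<bullet> (N *v w) - m * (u \<bullet> w)"
    have "0 \<le> 0 - 2 * c * g + c\<^sup>2 * (u \<bullet> (N *v u) - m * (u \<bullet> u))" for c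
    proof -
      have "w - c *\<^sub>R u \<in> V" using wV that by (simp add: V_def)
      from ray[OF this] show ?thesis
        using symmetric_matrix_inner[OF sym, of u w]
        by (simp add: g_def m_def[symmetric] ww matrix_vector_mult_diff_distrib inner_diff_left inner_diff_right
            matrix_vector_mult_scaleR power2_eq_square inner_commute[of w u] algebra_simps)
    qed
    from quadratic_nonneg_imp_discriminant[OF this] ray[OF that] have "g = 0" by simp
    then show ?thesis by (simp add: g_def)
  qed
  have restr: "(\<Sum>j\<in>S. N $ i $ j * u $ j) = (N *v u) $ i" if "u \<in> V" for u i
    unfolding matrix_vector_mult_def vec_lambda_beta
    by (rule sum.mono_neutral_left) (use that in \<open>auto simp: V_def\<close>)
  have "eigenvalue_on S N m"
    unfolding eigenvalue_on_def
  proof (intro exI[of _ w] conjI ballI)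
    have "w \<noteq> 0" using ww by auto
    then show "\<exists>i\<in>S. w $ i \<noteq> 0" using wV by (auto simp: V_def vec_eq_iff)
    fix i assume "i \<in> S"
    then have "axis i 1 \<in> V" by (auto simp: V_def axis_def)
    from stat[OF this] show "(\<Sum>j\<in>S. N $ i $ j * w $ j) = m * w $ i"
      by (simp add: restr[OF wV] inner_axis')
  qed
  moreover have "m \<le> l" if "eigenvalue_on S N l" for l
  proof -
    obtain u where u0: "\<exists>i\<in>S. u $ i \<noteq> 0"
      and u: "\<And>i. i \<in> S \<Longrightarrow> (\<Sum>j\<in>S. N $ i $ j * u $ j) = l * u $ i"
      using \<open>eigenvalue_on S N l\<close> unfolding eigenvalue_on_def by blast
    \<comment> \<open>An eigenvector in the sense of \<open>eigenvalue_on\<close> has arbitrary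
      entries off \<open>S\<close>; zeroing them makes \<open>ray\<close> applicable.\<close>
    define z where "z = (\<chi> i. if i \<in> S then u $ i else 0)"
    have zV: "z \<in> V" by (simp add: V_def z_def)
    have "z \<noteq> 0" using u0 by (auto simp: z_def vec_eq_iff)
    have "z $ i * (N *v z) $ i = l * (z $ i * z $ i)" for i
      using u[of i] unfolding restr[OF zV, symmetric] by (simp add: z_def)
    then have "z \<bullet> (N *v z) = l * (z \<bullet> z)"
      by (simp only: inner_vec_def sum_distrib_left inner_real_def)
    with ray[OF zV] \<open>z \<noteq> 0\<close> show ?thesis by simp
  qed
  ultimately have "lambda_min_on S N = m"
    unfolding lambda_min_on_def by (rule Least_equality)
  then show ?thesis using ray[OF VI[OF v]] by simp
qed

text \<open>The vector \<open>e\<close> is \<open>x\<close> minus the multiple of \<open>P x = - y\<close> that makes it orthogonal to \<open>x\<close>;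
  subtracting \<open>(a + s / \<eta>) x\<close> from \<open>u\<close> leaves a form in which \<open>e\<close> is the only cross term.\<close>

lemma schur_form_nonneg:
  fixes P :: "real^'d^'d" and x y u e :: "real^'d"
  assumes sym: "transpose P = P"
    and coercive: "\<And>v. (\<And>i. i \<notin> S \<Longrightarrow> v $ i = 0) \<Longrightarrow> \<delta> * (v \<bullet> v) \<le> v \<bullet> (P *v v)"
    and Px: "\<And>v. (\<And>i. i \<notin> S \<Longrightarrow> v $ i = 0) \<Longrightarrow> v \<bullet> (P *v x) = - (y \<bullet> v)"
    and x: "\<And>i. i \<notin> S \<Longrightarrow> x $ i = 0" and u: "\<And>i. i \<notin> S \<Longrightarrow> u $ i = 0"
    and \<eta>: "0 < \<eta>" "y \<bullet> x = - \<eta>" and \<sigma>: "0 < \<sigma>" "x \<bullet> x = \<sigma>" and \<delta>: "0 < \<delta>"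
    and e: "e = x + (\<sigma> / \<eta>) *\<^sub>R y"
  shows "0 \<le> \<eta> * a\<^sup>2 + 2 * a * (y \<bullet> u + s) + u \<bullet> (P *v u) - 2 * s * (x \<bullet> u) / \<sigma>
    + (1 / \<eta> + (e \<bullet> e) / (\<delta> * \<sigma>\<^sup>2)) * s\<^sup>2"
proof -
  define \<kappa> where "\<kappa> = a + s / \<eta>"
  define v where "v = u - \<kappa> *\<^sub>R x"
  have v: "v $ i = 0" if "i \<notin> S" for i using that x u by (simp add: v_def)
  have Pv: "u \<bullet> (P *v u) = v \<bullet> (P *v v) - 2 * \<kappa> * (y \<bullet> u) - \<kappa>\<^sup>2 * \<eta>"
    using Px[OF u] Px[OF x] symmetric_matrix_inner[OF sym, of x u] \<eta>(2)
    by (simp add: v_def matrix_vector_mult_diff_distrib inner_diff_left inner_diff_right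
        matrix_vector_mult_scaleR power2_eq_square algebra_simps)
  have ex: "e \<bullet> x = 0" using \<eta> \<sigma> by (simp add: e inner_add_left)
  have ev: "e \<bullet> v = x \<bullet> u + \<sigma> / \<eta> * (y \<bullet> u)"
    by (simp add: v_def inner_diff_right ex) (simp add: e inner_add_left)
  \<comment> \<open>Coercivity lends \<open>\<delta> * (v \<bullet> v)\<close> to complete the
    square around the cross term in \<open>e\<close>. The price is the second summand in the
    coefficient of \<open>s\<^sup>2\<close>.\<close>
  have "0 \<le> (\<delta> *\<^sub>R v - (s / \<sigma>) *\<^sub>R e) \<bullet> (\<delta> *\<^sub>R v - (s / \<sigma>) *\<^sub>R e) / \<delta>"
    using \<delta> by (intro divide_nonneg_pos inner_ge_zero)
  also have "\<dots> = \<delta> * (v \<bullet> v) - 2 * (s / \<sigma>) * (e \<bullet> v) + s\<^sup>2 * (e \<bullet> e) / (\<delta> * \<sigma>\<^sup>2)"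
    using \<delta> \<sigma>(1) by (simp add: inner_diff_left inner_diff_right inner_commute[of v e] power2_eq_square field_simps)
  also have "\<dots> \<le> v \<bullet> (P *v v) - 2 * (s / \<sigma>) * (e \<bullet> v) + s\<^sup>2 * (e \<bullet> e) / (\<delta> * \<sigma>\<^sup>2)"
    using coercive[OF v] by simp
  also have "\<dots> = \<eta> * a\<^sup>2 + 2 * a * (y \<bullet> u + s) + u \<bullet> (P *v u) - 2 * s * (x \<bullet> u) / \<sigma>
    + (1 / \<eta> + (e \<bullet> e) / (\<delta> * \<sigma>\<^sup>2)) * s\<^sup>2"
    unfolding Pv ev \<kappa>_def using \<eta>(1) \<sigma>(1) \<delta>
    by (simp add: field_simps power2_eq_square)
  finally show ?thesis .
qed

section \<open>Bordered matrices and the objective as a pairing\<close>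

text \<open>One shape serves both the cost matrix and the dual slack matrix. They share the border
  \<open>y_star M b\<close>, so they differ only in the corner and in the lower block.\<close>

definition bordered :: "real \<Rightarrow> real^'d \<Rightarrow> real^'d^'d \<Rightarrow> real^('d::finite option)^('d option)" where
  "bordered \<eta> y Z = (\<chi> i j. case i of
     None \<Rightarrow> (case j of None \<Rightarrow> \<eta> | Some l \<Rightarrow> y $ l)
   | Some k \<Rightarrow> (case j of None \<Rightarrow> y $ k | Some l \<Rightarrow> Z $ k $ l))"

lemma sum_UNIV_option:
  "(\<Sum>i\<in>UNIV. f i) = f None + (\<Sum>i\<in>UNIV. f (Some i))"
  for f :: "'d::finite option \<Rightarrow> 'a::comm_monoid_add"
  by (simp add: UNIV_option_conv sum.reindex)

lemma bordered_pairing: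
  fixes W :: "real^('d::finite option)^('d option)"
  assumes "transpose W = W"
  shows "(\<Sum>i\<in>UNIV. \<Sum>j\<in>UNIV. bordered \<eta> y Z $ i $ j * W $ i $ j)
    = \<eta> * W $ None $ None + 2 * (\<Sum>k\<in>UNIV. y $ k * W $ None $ Some k)
      + (\<Sum>k\<in>UNIV. \<Sum>l\<in>UNIV. Z $ k $ l * x_block W $ k $ l)"
  by (simp add: bordered_def x_block_def sum_UNIV_option sum.distrib
      sym_entry[OF assms, of "Some _" None])

lemma bordered_quadratic:
  fixes v :: "real^('d::finite option)"
  shows "v \<bullet> (bordered \<eta> y Z *v v) = \<eta> * (v $ None)\<^sup>2
    + 2 * (v $ None) * (y \<bullet> (\<chi> k. v $ Some k)) + (\<chi> k. v $ Some k) \<bullet> (Z *v (\<chi> k. v $ Some k))"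
  by (simp add: bordered_def inner_vec_def matrix_vector_mult_def sum_UNIV_option
      power2_eq_square sum_distrib_left sum_distrib_right sum.distrib algebra_simps)

lemma augmented_gram:
  "(1 / real CARD('n)) *\<^sub>R (transpose (augmented M b) ** augmented M b)
    = bordered ((b \<bullet> b) / real CARD('n)) (y_star M b) (gram M)"
  for M :: "real^'d::finite^'n"
  by (simp add: vec_eq_iff bordered_def augmented_def gram_def y_star_def matrix_matrix_mult_def
      transpose_def inner_vec_def matrix_vector_mult_def sum_negf mult.commute split: option.split)

lemma sdp_objective_pairing:
  fixes M :: "real^'d::finite^'n"
  assumes "transpose W = W"
  shows "sdp_objective M b W = (b \<bullet> b) / real CARD('n) * W $ None $ None
      + 2 * (\<Sum>k\<in>UNIV. y_star M b $ k * W $ None $ Some k)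
      + (\<Sum>k\<in>UNIV. \<Sum>l\<in>UNIV. gram M $ k $ l * x_block W $ k $ l)"
proof -
  have "sdp_objective M b W = (\<Sum>i\<in>UNIV. \<Sum>j\<in>UNIV.
      ((1 / real CARD('n)) *\<^sub>R (transpose (augmented M b) ** augmented M b)) $ i $ j * W $ i $ j)"
    unfolding sdp_objective_def trace_def
      matrix_matrix_mult_def[of "transpose (augmented M b) ** augmented M b" W]
    by (simp add: sum_distrib_left mult.assoc sym_entry[OF assms])
  then show ?thesis
    unfolding augmented_gram bordered_pairing[OF assms] .
qed

section \<open>Feasibility of the lift, and its reconstruction from partial data\<close>

lemma sdp_feasible_rank_one_lift:
  fixes x :: "real^'d::finite"
  assumes x: "\<forall>i. x $ i \<in> {0, 1, -1}" and card: "card (supp x) = \<sigma>"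
  shows "sdp_feasible \<sigma> (rank_one_lift x)"
proof -
  have abs: "\<bar>x $ i\<bar> = (if i \<in> supp x then 1 else 0)" "x $ i * x $ i = (if i \<in> supp x then 1 else 0)" for i
    using x[rule_format, of i] by (auto simp: supp_def)
  have "psd (rank_one_lift x)"
    unfolding psd_def
  proof (intro conjI allI)
    show "transpose (rank_one_lift x) = rank_one_lift x"
      by (simp add: rank_one_lift_def transpose_def vec_eq_iff mult.commute)
    fix v
    have "v \<bullet> (rank_one_lift x *v v) = (lift_vec x \<bullet> v)\<^sup>2"
      by (simp add: rank_one_lift_def inner_vec_def matrix_vector_mult_def power2_eq_square
          sum_product sum_distrib_left mult_ac)
    then show "0 \<le> v \<bullet> (rank_one_lift x *v v)" by simp
  qed
  moreover have "x_block (rank_one_lift x) $ i $ j = x $ i * x $ j" for i j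
    by (simp add: x_block_def rank_one_lift_def lift_vec_def)
  moreover have "(\<Sum>i\<in>UNIV. \<Sum>j\<in>UNIV. \<bar>x $ i\<bar> * \<bar>x $ j\<bar>) = (real \<sigma>)\<^sup>2"
    unfolding sum_product[symmetric] by (simp add: abs sum.If_cases card power2_eq_square)
  ultimately show ?thesis
    by (simp add: sdp_feasible_def trace_def abs abs_mult sum.If_cases card)
       (simp add: rank_one_lift_def lift_vec_def)
qed

text \<open>Split the first row into \<open>\<alpha> *\<^sub>R x\<close> and a part \<open>u\<close>
  orthogonal to \<open>x\<close>. The form of \<open>W\<close> vanishes at \<open>(0, u)\<close>, so
  by Cauchy-Schwarz \<open>u\<close> is orthogonal to that row and hence zero. The pairing with
  \<open>y\<close> then gives \<open>\<alpha> = 1\<close>.\<close>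

lemma rank_one_extension:
  fixes W :: "real^('d::finite option)^('d option)" and x :: "real^'d"
  assumes W: "psd W" "W $ None $ None = 1"
    and X: "\<And>i j. x_block W $ i $ j = x $ i * x $ j" and x: "x \<noteq> 0"
    and y: "(\<Sum>k\<in>UNIV. y $ k * W $ None $ Some k) = y \<bullet> x" "y \<bullet> x \<noteq> 0"
  shows "W = rank_one_lift x"
proof -
  define w where "w = (\<chi> k. W $ None $ Some k)"
  define \<alpha> where "\<alpha> = (w \<bullet> x) / (x \<bullet> x)"
  define u where "u = w - \<alpha> *\<^sub>R x"
  define v where "v = (\<chi> i. case i of None \<Rightarrow> 0 | Some k \<Rightarrow> u $ k)"
  have ux: "u \<bullet> x = 0" using x by (simp add: u_def \<alpha>_def inner_diff_left)
  have "v \<bullet> (W *v v) = (u \<bullet> x)\<^sup>2"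
    using X by (simp add: v_def x_block_def inner_vec_def matrix_vector_mult_def sum_UNIV_option
        power2_eq_square sum_product sum_distrib_left mult_ac)
  moreover have "axis None 1 \<bullet> (W *v v) = w \<bullet> u"
    by (simp add: inner_axis' matrix_vector_mult_def sum_UNIV_option v_def)
       (simp add: w_def inner_vec_def)
  ultimately have "w \<bullet> u = 0"
    using psd_cauchy_schwarz[OF W(1), of "axis None 1" v] ux by simp
  moreover have "u \<bullet> u = w \<bullet> u - \<alpha> * (u \<bullet> x)"
    by (subst (1) u_def) (simp only: inner_diff_left inner_scaleR_left inner_commute[of x u])
  ultimately have "w = \<alpha> *\<^sub>R x" using ux by (simp add: u_def)
  moreover have "y \<bullet> w = y \<bullet> x"
    using y(1) by (simp add: w_def inner_vec_def)
  ultimately have "w = x" using y(2) by simp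
  then have "W $ None $ Some k = x $ k" for k by (auto simp: w_def)
  moreover have "W $ Some k $ None = W $ None $ Some k" for k
    using W(1) sym_entry by (auto simp: psd_def)
  ultimately have "W $ i $ j = rank_one_lift x $ i $ j" for i j
    using X W(2) by (cases i; cases j) (auto simp: rank_one_lift_def lift_vec_def x_block_def)
  then show ?thesis by (simp add: vec_eq_iff)
qed

lemma sum_le_imp_eq:
  fixes f g :: "'a \<Rightarrow> real"
  assumes "finite A" "\<And>i. i \<in> A \<Longrightarrow> f i \<le> g i" "sum g A \<le> sum f A" "i \<in> A"
  shows "f i = g i"
proof (rule ccontr)
  assume "f i \<noteq> g i"
  then have "sum f A < sum g A"
    using assms by (intro sum_strict_mono_ex1) (auto simp: less_le)
  with assms(3) show False by simp
qed

lemma sum_sum_le_imp_eq: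
  fixes f g :: "'a::finite \<Rightarrow> 'a \<Rightarrow> real"
  assumes "\<And>i j. f i j \<le> g i j" "(\<Sum>i\<in>UNIV. \<Sum>j\<in>UNIV. g i j) \<le> (\<Sum>i\<in>UNIV. \<Sum>j\<in>UNIV. f i j)"
  shows "f i j = g i j"
proof -
  have "(\<Sum>j\<in>UNIV. f i j) = (\<Sum>j\<in>UNIV. g i j)"
    by (rule sum_le_imp_eq[of UNIV _ _ i]) (use assms in \<open>auto intro: sum_mono\<close>)
  then show ?thesis
    by (intro sum_le_imp_eq[of UNIV "f i" "g i"]) (use assms in auto)
qed

text \<open>The 2 x 2 minors and the diagonal bound keep each entry on the support within absolute
  value 1. These bounds add up to \<open>\<sigma>\<close> squared, so reaching that total makes all
  of them tight, and \<open>sgn\<close> supplies the signs.\<close>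

lemma x_block_determined:
  fixes x :: "real^'d::finite"
  assumes feas: "sdp_feasible \<sigma> W"
    and x: "\<forall>i. x $ i \<in> {0, 1, -1}" and card: "card (supp x) = \<sigma>"
    and off: "\<And>i j. i \<notin> supp x \<or> j \<notin> supp x \<Longrightarrow> x_block W $ i $ j = 0"
    and sgn: "\<And>i j. i \<in> supp x \<Longrightarrow> j \<in> supp x \<Longrightarrow>
      x $ i * x $ j * x_block W $ i $ j = \<bar>x_block W $ i $ j\<bar>"
    and total: "(real \<sigma>)\<^sup>2 \<le> (\<Sum>i\<in>UNIV. \<Sum>j\<in>UNIV. \<bar>x_block W $ i $ j\<bar>)"
  shows "x_block W $ i $ j = x $ i * x $ j"
proof -
  let ?X = "x_block W"
  have ind: "\<bar>x $ i\<bar> = (if i \<in> supp x then 1 else 0)" for i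
    using x[rule_format, of i] by (auto simp: supp_def)
  have W: "psd W" "\<And>i. ?X $ i $ i \<le> 1" using feas by (auto simp: sdp_feasible_def)
  have bound: "\<bar>?X $ i $ j\<bar> \<le> \<bar>x $ i\<bar> * \<bar>x $ j\<bar>" for i j
  proof (cases "i \<in> supp x \<and> j \<in> supp x")
    case True
    have "(?X $ i $ j)\<^sup>2 \<le> ?X $ i $ i * ?X $ j $ j"
      using psd_entry_bound[OF W(1), of "Some i" "Some j"] by (simp add: x_block_def)
    also have "\<dots> \<le> 1 * 1"
      using W(2) psd_diag_nonneg[OF W(1)] by (intro mult_mono) (auto simp: x_block_def)
    finally show ?thesis using True by (simp add: ind abs_square_le_1)
  qed (use off in auto)
  have "(\<Sum>i\<in>UNIV. \<Sum>j\<in>UNIV. \<bar>x $ i\<bar> * \<bar>x $ j\<bar>) = (real \<sigma>)\<^sup>2"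
    unfolding sum_product[symmetric] by (simp add: ind sum.If_cases card power2_eq_square)
  then have eq: "\<bar>?X $ i $ j\<bar> = \<bar>x $ i\<bar> * \<bar>x $ j\<bar>"
    by (intro sum_sum_le_imp_eq[of "\<lambda>i j. \<bar>?X $ i $ j\<bar>" "\<lambda>i j. \<bar>x $ i\<bar> * \<bar>x $ j\<bar>"] bound)
       (use total in simp)
  show ?thesis
  proof (cases "i \<in> supp x \<and> j \<in> supp x")
    case True
    then have "x $ i \<in> {1, -1}" "x $ j \<in> {1, -1}" "\<bar>?X $ i $ j\<bar> = 1"
      using x[rule_format, of i] x[rule_format, of j] eq by (auto simp: ind supp_def)
    with sgn[of i j] True show ?thesis by auto
  next
    case False
    then show ?thesis using off[of i j] by (auto simp: supp_def)
  qed
qed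

section \<open>Weak duality and complementary slackness\<close>

text \<open>Here \<open>\<mu>\<close>, \<open>p\<close> and \<open>K\<close> are the multipliers of
  the trace, diagonal and absolute-sum constraints, and the bordered matrix is that of
  semidefiniteness. The lift attains the dual bound; strictness in \<open>off\<close> yields
  uniqueness.\<close>

lemma sdp_recovers_certificate:
  fixes M :: "real^'d^'n" and x :: "real^'d" and Z :: "real^'d^'d"
  assumes \<sigma>: "0 < \<sigma>" and x: "\<forall>i. x $ i \<in> {0, 1, -1}" and card: "card (supp x) = \<sigma>"
    and \<eta>: "0 < \<eta>" "y_star M b \<bullet> x = - \<eta>"
    and cert: "\<And>v. 0 \<le> v \<bullet> (bordered \<eta> (y_star M b) Z *v v)" "x \<bullet> (Z *v x) = \<eta>"
    and K: "0 < K" and p: "\<And>i. i \<in> supp x \<Longrightarrow> 0 \<le> p i"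
    and on: "\<And>i j. i \<in> supp x \<Longrightarrow> j \<in> supp x \<Longrightarrow>
      Z $ i $ j = gram M $ i $ j + (if i = j then \<mu> + p i else 0) + K * (x $ i * x $ j)"
    and off: "\<And>i j. i \<notin> supp x \<or> j \<notin> supp x \<Longrightarrow>
      \<bar>Z $ i $ j - gram M $ i $ j - (if i = j then \<mu> else 0)\<bar> < K"
  shows "sdp_recovers \<sigma> M b x"
proof -
  let ?S = "supp x" and ?y = "y_star M b" and ?G = "gram M" and ?R = "rank_one_lift x"
  define p' where "p' i = (if i \<in> ?S then p i else 0)" for i
  define E where "E i j = Z $ i $ j - ?G $ i $ j" for i j
  \<comment> \<open>Entrywise bound for the pairing with \<open>E\<close>; summed over a feasible
    block it is at most \<open>L\<close>, by the trace, diagonal and absolute-sum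
    constraints.\<close>
  define l where "l X i j = (if i = j then \<mu> * X $ i $ i + p' i * X $ i $ i else 0) + K * \<bar>X $ i $ j\<bar>"
    for X :: "real^'d^'d" and i j
  define L where "L = \<mu> * \<sigma> + (\<Sum>i\<in>UNIV. p' i) + K * (real \<sigma>)\<^sup>2"
  have p': "0 \<le> p' i" for i using p by (simp add: p'_def)
  have ind: "\<bar>x $ i\<bar> = (if i \<in> ?S then 1 else 0)" "x $ i * x $ i = (if i \<in> ?S then 1 else 0)" for i
    using x[rule_format, of i] by (auto simp: supp_def)
  have lift: "sdp_feasible \<sigma> ?R" by (rule sdp_feasible_rank_one_lift[OF x card])
  have sum_l: "(\<Sum>i\<in>UNIV. \<Sum>j\<in>UNIV. l (x_block W) i j) = \<mu> * \<sigma> + (\<Sum>i\<in>UNIV. p' i * x_block W $ i $ i)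
      + K * (\<Sum>i\<in>UNIV. \<Sum>j\<in>UNIV. \<bar>x_block W $ i $ j\<bar>)" if "sdp_feasible \<sigma> W" for W
    using that by (simp add: l_def sdp_feasible_def trace_def sum.distrib
        sum_distrib_left[symmetric])
  have entry: "E i j * x_block W $ i $ j \<le> l (x_block W) i j"
      "E i j * x_block W $ i $ j = l (x_block W) i j \<Longrightarrow> i \<notin> ?S \<or> j \<notin> ?S \<Longrightarrow> x_block W $ i $ j = 0"
      "E i j * x_block W $ i $ j = l (x_block W) i j \<Longrightarrow> i \<in> ?S \<Longrightarrow> j \<in> ?S \<Longrightarrow>
        x $ i * x $ j * x_block W $ i $ j = \<bar>x_block W $ i $ j\<bar>"
    for W :: "real^('d option)^('d option)" and i j
  proof -
    let ?X = "x_block W"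
    \<comment> \<open>Removing the diagonal multipliers from \<open>E\<close> leaves
      \<open>K\<close> times the entry of \<open>U\<close>: exactly
      \<open>K * (x $ i * x $ j)\<close> on the support, strictly inside \<open>(-K, K)\<close>
      elsewhere.\<close>
    define d where "d = E i j - (if i = j then \<mu> + p' i else 0)"
    have eq: "l ?X i j - E i j * ?X $ i $ j = K * \<bar>?X $ i $ j\<bar> - d * ?X $ i $ j"
      by (simp add: l_def d_def algebra_simps)
    show "E i j * ?X $ i $ j \<le> l ?X i j"
      "E i j * ?X $ i $ j = l ?X i j \<Longrightarrow> i \<notin> ?S \<or> j \<notin> ?S \<Longrightarrow> ?X $ i $ j = 0"
      "E i j * ?X $ i $ j = l ?X i j \<Longrightarrow> i \<in> ?S \<Longrightarrow> j \<in> ?S \<Longrightarrow>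
        x $ i * x $ j * ?X $ i $ j = \<bar>?X $ i $ j\<bar>"
    proof -
      have mul: "d * ?X $ i $ j \<le> \<bar>d\<bar> * \<bar>?X $ i $ j\<bar>" by (metis abs_ge_self abs_mult)
      have dS: "d = K * (x $ i * x $ j)" if "i \<in> ?S" "j \<in> ?S"
        using on[OF that] that by (auto simp: d_def E_def p'_def)
      have doff: "\<bar>d\<bar> < K" if "i \<notin> ?S \<or> j \<notin> ?S"
        using off[OF that] that by (auto simp: d_def E_def p'_def split: if_splits)
      have "\<bar>d\<bar> \<le> K"
        using dS doff K ind(1)[of i] ind(1)[of j] by (cases "i \<in> ?S \<and> j \<in> ?S") (auto simp: abs_mult)
      then have "\<bar>d\<bar> * \<bar>?X $ i $ j\<bar> \<le> K * \<bar>?X $ i $ j\<bar>" by (rule mult_right_mono) simp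
      then show "E i j * ?X $ i $ j \<le> l ?X i j" using mul eq by simp
      assume e: "E i j * ?X $ i $ j = l ?X i j"
      { assume "i \<notin> ?S \<or> j \<notin> ?S"
        from doff[OF this] show "?X $ i $ j = 0"
          using mul e eq mult_strict_right_mono[of "\<bar>d\<bar>" K "\<bar>?X $ i $ j\<bar>"] by force }
      { assume "i \<in> ?S" "j \<in> ?S"
        from dS[OF this] show "x $ i * x $ j * ?X $ i $ j = \<bar>?X $ i $ j\<bar>"
          using e eq K by simp }
    qed
  qed
  \<comment> \<open>The common border cancels between cost and slack; the corners contribute
    constants since \<open>W $ None $ None = 1\<close>.\<close>
  have pair: "sdp_objective M b W = (b \<bullet> b) / real CARD('n) - \<eta>
      + (\<Sum>i\<in>UNIV. \<Sum>j\<in>UNIV. bordered \<eta> ?y Z $ i $ j * W $ i $ j)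
      - (\<Sum>i\<in>UNIV. \<Sum>j\<in>UNIV. E i j * x_block W $ i $ j)" if "sdp_feasible \<sigma> W" for W
  proof -
    have "transpose W = W" "W $ None $ None = 1" using that by (auto simp: sdp_feasible_def psd_def)
    then show ?thesis
      by (simp add: sdp_objective_pairing bordered_pairing E_def left_diff_distrib sum_subtractf)
  qed
  have pairing: "0 \<le> (\<Sum>i\<in>UNIV. \<Sum>j\<in>UNIV. bordered \<eta> ?y Z $ i $ j * W $ i $ j)"
    if "sdp_feasible \<sigma> W" for W
    using that by (intro psd_pairing_nonneg cert(1)) (simp add: sdp_feasible_def)
  have sum_l_le: "(\<Sum>i\<in>UNIV. p' i * x_block W $ i $ i) \<le> (\<Sum>i\<in>UNIV. p' i)"
      "K * (\<Sum>i\<in>UNIV. \<Sum>j\<in>UNIV. \<bar>x_block W $ i $ j\<bar>) \<le> K * (real \<sigma>)\<^sup>2"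
    if "sdp_feasible \<sigma> W" for W
    using that p' K by (auto simp: sdp_feasible_def intro!: sum_mono mult_left_le)
  have sum_E: "(\<Sum>i\<in>UNIV. \<Sum>j\<in>UNIV. E i j * x_block W $ i $ j)
      \<le> (\<Sum>i\<in>UNIV. \<Sum>j\<in>UNIV. l (x_block W) i j)" for W
    by (intro sum_mono entry(1))
  have lower: "(b \<bullet> b) / real CARD('n) - \<eta> - L \<le> sdp_objective M b W" if "sdp_feasible \<sigma> W" for W
    using pair[OF that] pairing[OF that] sum_l_le[OF that] sum_l[OF that] sum_E[of W]
    unfolding L_def by linarith
  have attained: "sdp_objective M b ?R = (b \<bullet> b) / real CARD('n) - \<eta> - L"
  proof -
    have xb: "x_block ?R $ i $ j = x $ i * x $ j" for i j
      by (simp add: x_block_def rank_one_lift_def lift_vec_def)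
    have tr: "transpose ?R = ?R" using lift by (simp add: sdp_feasible_def psd_def)
    have quad: "(\<Sum>i\<in>UNIV. \<Sum>j\<in>UNIV. Z $ i $ j * (x $ i * x $ j)) = \<eta>"
      using cert(2) by (simp add: inner_vec_def matrix_vector_mult_def sum_distrib_left mult_ac)
    have "(\<Sum>k\<in>UNIV. ?y $ k * ?R $ None $ Some k) = - \<eta>"
      using \<eta>(2) by (simp add: inner_vec_def rank_one_lift_def lift_vec_def)
    then have "(\<Sum>i\<in>UNIV. \<Sum>j\<in>UNIV. bordered \<eta> ?y Z $ i $ j * ?R $ i $ j) = 0"
      unfolding bordered_pairing[OF tr] xb quad by (simp add: rank_one_lift_def lift_vec_def)
    moreover have "(\<Sum>i\<in>UNIV. \<Sum>j\<in>UNIV. E i j * x_block ?R $ i $ j)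
        = (\<Sum>i\<in>UNIV. \<Sum>j\<in>UNIV. l (x_block ?R) i j)"
    proof (intro sum.cong refl)
      fix i j
      show "E i j * x_block ?R $ i $ j = l (x_block ?R) i j"
      proof (cases "i \<in> ?S \<and> j \<in> ?S")
        case True
        then show ?thesis
          using ind(2)[of i] ind(2)[of j] x[rule_format, of i] x[rule_format, of j] on[of i j]
          by (auto simp: E_def l_def xb p'_def algebra_simps)
      next
        case False
        then have "x $ i * x $ j = 0" by (auto simp: supp_def)
        then show ?thesis by (auto simp: l_def xb)
      qed
    qed
    moreover have "(\<Sum>i\<in>UNIV. p' i * x_block ?R $ i $ i) = (\<Sum>i\<in>UNIV. p' i)"
      by (simp add: xb ind p'_def if_distrib cong: if_cong)
    moreover have "(\<Sum>i\<in>UNIV. \<Sum>j\<in>UNIV. \<bar>x_block ?R $ i $ j\<bar>) = (real \<sigma>)\<^sup>2"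
      unfolding xb abs_mult sum_product[symmetric]
      by (simp add: ind sum.If_cases card power2_eq_square)
    ultimately show ?thesis
      using pair[OF lift] sum_l[OF lift] by (simp add: L_def)
  qed
  have unique: "W = ?R" if opt: "sdp_optimal \<sigma> M b W" for W
  proof -
    let ?X = "x_block W"
    have feas: "sdp_feasible \<sigma> W" using opt by (simp add: sdp_optimal_def)
    have "sdp_objective M b W \<le> sdp_objective M b ?R"
      using opt lift by (simp add: sdp_optimal_def)
    \<comment> \<open>An optimal \<open>W\<close> has at most the value of the lift, so every
      inequality behind \<open>lower\<close> is tight; the equalities are extracted one at a
      time.\<close>
    note facts = this[unfolded attained] pair[OF feas] pairing[OF feas] sum_l_le[OF feas]
      sum_l[OF feas] sum_E[of W]
    have "(\<Sum>i\<in>UNIV. \<Sum>j\<in>UNIV. l ?X i j) \<le> (\<Sum>i\<in>UNIV. \<Sum>j\<in>UNIV. E i j * ?X $ i $ j)"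
      using facts unfolding L_def by linarith
    then have eq: "E i j * ?X $ i $ j = l ?X i j" for i j
      by (intro sum_sum_le_imp_eq[of "\<lambda>i j. E i j * ?X $ i $ j"] entry(1))
    have "K * (real \<sigma>)\<^sup>2 \<le> K * (\<Sum>i\<in>UNIV. \<Sum>j\<in>UNIV. \<bar>?X $ i $ j\<bar>)"
      using facts unfolding L_def by linarith
    then have "(real \<sigma>)\<^sup>2 \<le> (\<Sum>i\<in>UNIV. \<Sum>j\<in>UNIV. \<bar>?X $ i $ j\<bar>)" using K by simp
    then have X: "?X $ i $ j = x $ i * x $ j" for i j
      using entry(2,3)[OF eq] by (intro x_block_determined[OF feas x card]) auto
    have W: "psd W" "W $ None $ None = 1" using feas by (auto simp: sdp_feasible_def)
    have quad: "(\<Sum>i\<in>UNIV. \<Sum>j\<in>UNIV. Z $ i $ j * (x $ i * x $ j)) = \<eta>"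
      using cert(2) by (simp add: inner_vec_def matrix_vector_mult_def sum_distrib_left mult_ac)
    \<comment> \<open>With the block known, this zero reads
      \<open>\<eta> + 2 * s + \<eta> = 0\<close> for the pairing \<open>s\<close> of
      \<open>y\<close> with the first row, so \<open>s = - \<eta>\<close>.\<close>
    have "(\<Sum>i\<in>UNIV. \<Sum>j\<in>UNIV. bordered \<eta> ?y Z $ i $ j * W $ i $ j) = 0"
      using facts unfolding L_def by linarith
    moreover have "transpose W = W" using W(1) by (simp add: psd_def)
    ultimately have "(\<Sum>k\<in>UNIV. ?y $ k * W $ None $ Some k) = ?y \<bullet> x"
      using quad \<eta>(2) by (simp add: bordered_pairing X W(2))
    then show ?thesis
      using \<eta> by (intro rank_one_extension[where y = ?y, OF W X]) auto
  qed
  moreover have "sdp_optimal \<sigma> M b ?R"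
    unfolding sdp_optimal_def attained using lift lower by blast
  ultimately show ?thesis unfolding sdp_recovers_def using x by blast
qed

section \<open>Estimates for the Gram matrix and the angle\<close>

lemma linf_on_upper: "finite I \<Longrightarrow> i \<in> I \<Longrightarrow> \<bar>f i\<bar> \<le> linf_on I f"
  by (simp add: linf_on_def)

lemma linf_on_nonneg: "finite I \<Longrightarrow> 0 \<le> linf_on I f"
  by (simp add: linf_on_def)

lemma gram_entry:
  fixes M :: "real^'d^'n"
  shows "gram M $ i $ j = (transpose M ** M) $ i $ j / real CARD('n)"
  by (simp add: gram_def)

lemma transpose_gram: "transpose (gram M) = gram M"
  by (simp add: vec_eq_iff gram_entry transpose_def matrix_matrix_mult_def mult.commute)

text \<open>Columns of norm at most 1 make the normalising denominator at most 1, and the factor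
  \<open>1/n\<close> only shrinks. A nonzero entry has nonzero columns, so \<open>0/0\<close> arises
  only where the bound is trivial.\<close>

lemma gram_off_diagonal_le_coherence:
  fixes M :: "real^'d^'n"
  assumes cols: "\<And>k. norm (column k M) \<le> 1" and "i \<noteq> j"
  shows "\<bar>gram M $ i $ j\<bar> \<le> coherence (transpose M ** M)"
proof -
  let ?N = "transpose M ** M"
  have N: "?N $ k $ l = column k M \<bullet> column l M" for k l
    by (simp add: matrix_matrix_mult_def transpose_def column_def inner_vec_def)
  have root: "sqrt \<bar>?N $ i $ i * ?N $ j $ j\<bar> = norm (column i M) * norm (column j M)"
    by (simp add: N abs_mult real_sqrt_mult norm_eq_sqrt_inner)
  have "finite {\<bar>?N $ i $ j\<bar> / sqrt \<bar>?N $ i $ i * ?N $ j $ j\<bar> | i j. i \<noteq> j}"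
    by (rule finite_subset[of _ "(\<lambda>(i, j). \<bar>?N $ i $ j\<bar> / sqrt \<bar>?N $ i $ i * ?N $ j $ j\<bar>) ` UNIV"])
       auto
  then have ratio: "\<bar>?N $ i $ j\<bar> / sqrt \<bar>?N $ i $ i * ?N $ j $ j\<bar> \<le> coherence ?N"
    unfolding coherence_def using \<open>i \<noteq> j\<close> by (intro Max_ge) auto
  have le1: "norm (column i M) * norm (column j M) \<le> 1"
    using cols by (intro mult_le_one) auto
  have "\<bar>?N $ i $ j\<bar> \<le> \<bar>?N $ i $ j\<bar> / sqrt \<bar>?N $ i $ i * ?N $ j $ j\<bar>"
  proof (cases "?N $ i $ j = 0")
    case False
    then have "column i M \<noteq> 0" "column j M \<noteq> 0" by (auto simp: N)
    then have "0 < norm (column i M) * norm (column j M)" by simp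
    then show ?thesis
      unfolding root using le1 by (simp add: pos_le_divide_eq mult_left_le)
  qed simp
  moreover have "\<bar>gram M $ i $ j\<bar> \<le> \<bar>?N $ i $ j\<bar>"
    by (simp add: gram_entry divide_le_eq mult_le_cancel_left1 Suc_leI)
  ultimately show ?thesis using ratio by linarith
qed

text \<open>Cauchy-Schwarz puts the argument of \<open>arccos\<close> into \<open>[-1, 1]\<close>,
  also for a zero denominator, where the quotient is 0. Squaring removes the sign in
  \<open>Y11_star\<close>.\<close>

lemma cos_theta_squared:
  fixes M :: "real^'d^'n" and x :: "real^'d"
  assumes x: "\<forall>i. x $ i \<in> {0, 1, -1}" and card: "card (supp x) = \<sigma>"
  shows "(cos (theta \<sigma> M b x))\<^sup>2
    = (Y11_star M b x)\<^sup>2 / (real \<sigma> * (\<Sum>i\<in>supp x. (y_star M b $ i)\<^sup>2))"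
proof -
  let ?y = "y_star M b"
  let ?L = "L2_set (\<lambda>i. ?y $ i) (supp x)"
  let ?c = "(\<Sum>i\<in>supp x. ?y $ i * x $ i) / (sqrt (real \<sigma>) * ?L)"
  have "(\<Sum>i\<in>supp x. (x $ i)\<^sup>2) = (\<Sum>i\<in>supp x. 1)"
    using x by (intro sum.cong refl) (auto simp: supp_def)
  then have "L2_set (\<lambda>i. x $ i) (supp x) = sqrt \<sigma>" by (simp add: L2_set_def card)
  then have "\<bar>\<Sum>i\<in>supp x. ?y $ i * x $ i\<bar> \<le> ?L * sqrt \<sigma>"
    using L2_set_mult_ineq[of "\<lambda>i. ?y $ i" "\<lambda>i. x $ i" "supp x"] sum_abs[of "\<lambda>i. ?y $ i * x $ i" "supp x"]
    by (simp add: abs_mult)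
  moreover have "\<bar>r / d\<bar> \<le> 1" if "\<bar>r\<bar> \<le> d" for r d :: real
    using that by (cases "d = 0") (auto simp: divide_le_eq_1)
  ultimately have "\<bar>?c\<bar> \<le> 1" by (simp only: mult.commute[of ?L])
  then have "cos (theta \<sigma> M b x) = ?c"
    unfolding theta_def by (rule cos_arccos_abs)
  then show ?thesis
    by (simp add: Y11_star_def power_divide power_mult_distrib L2_set_def sum_nonneg)
qed

section \<open>Construction of the certificate\<close>

theorem corollary5:
  fixes M :: "real^'d^'n" and b :: "real^'n" and x :: "real^'d" and \<sigma> :: nat and S :: "'d set"
  assumes "0 < \<sigma>" and "\<sigma> \<le> CARD('d)"
    and "\<forall>i. x $ i \<in> {0, 1, -1}"
    and "S = supp x" and "card S = \<sigma>"
    and "Y11_star M b x > 0"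
    and "Max (range (\<lambda>i. norm (column i M))) \<le> 1"
    and "\<exists>\<delta>>0. \<exists>\<Delta>>0.
      lambda_min_on S (gram M) - \<delta> - linf_on S (\<lambda>i. \<Sum>j\<in>S. gram M $ i $ j * x $ j)
          + min (Delta1 M b x) (Delta2 \<sigma> M b x \<delta>) \<ge> \<Delta> \<and>
      (\<exists>\<mu>\<^sub>2. \<mu>\<^sub>2 \<le> - lambda_min_on S (gram M) + \<delta> \<and>
          linf_on (- S) (\<lambda>i. (gram M + \<mu>\<^sub>2 *\<^sub>R mat 1) $ i $ i) < \<Delta> / real \<sigma>) \<and>
      coherence (transpose M ** M) < \<Delta> / real \<sigma>"
  shows "sdp_recovers \<sigma> M b x"
proof -
  note x = assms(3) and S = assms(4) and card = assms(5)
  obtain \<delta> \<Delta> \<mu> where \<delta>: "0 < \<delta>" and \<Delta>: "0 < \<Delta>"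
    and C1: "lambda_min_on S (gram M) - \<delta> - linf_on S (\<lambda>i. \<Sum>j\<in>S. gram M $ i $ j * x $ j)
          + min (Delta1 M b x) (Delta2 \<sigma> M b x \<delta>) \<ge> \<Delta>"
    and \<mu>: "\<mu> \<le> - lambda_min_on S (gram M) + \<delta>"
    and C2: "linf_on (- S) (\<lambda>i. (gram M + \<mu> *\<^sub>R mat 1) $ i $ i) < \<Delta> / real \<sigma>"
    and C3: "coherence (transpose M ** M) < \<Delta> / real \<sigma>"
    using assms(8) by blast
  define y where "y = y_star M b"
  define G where "G = gram M"
  define \<eta> where "\<eta> = Y11_star M b x"
  define \<kappa> where "\<kappa> = lambda_min_on S G"
  define c where "c = linf_on (- S) (\<lambda>i. y $ i)"
  define g where "g = linf_on S (\<lambda>i. \<Sum>j\<in>S. G $ i $ j * x $ j)"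
  define m where "m = Min ((\<lambda>i. - y $ i / x $ i) ` S)"
  define yS where "yS = (\<chi> i. if i \<in> S then y $ i else 0)"
  define yc where "yc = y - yS"
  define e where "e = x + (\<sigma> / \<eta>) *\<^sub>R yS"
  \<comment> \<open>The coefficient of \<open>s\<^sup>2\<close> in \<open>schur_form_nonneg\<close>,
    to be used with \<open>s = yc \<bullet> h\<close>.\<close>
  define t where "t = 1 / \<eta> + (e \<bullet> e) / (\<delta> * (real \<sigma>)\<^sup>2)"
  \<comment> \<open>Off \<open>S \<times> S\<close> the entries of \<open>Z\<close> are bounded by
    \<open>c / \<sigma>\<close> or by \<open>t * c\<^sup>2\<close>; \<open>K\<close> exceeds the
    larger bound by the margin \<open>\<Delta> / \<sigma>\<close>.\<close>
  define K where "K = (\<Delta> + max c (\<sigma> * t * c\<^sup>2)) / \<sigma>"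
  \<comment> \<open>\<open>q = \<mu> + p\<close> on \<open>S\<close>, solved from the rows in \<open>S\<close> of the kernel condition at \<open>(1, x)\<close>\<close>
  define q where "q i = - y $ i * x $ i - (G *v x) $ i * x $ i - K * \<sigma>" for i
  define P where "P = (\<chi> i j. G $ i $ j + (if i = j then q i else 0) + K * (x $ i * x $ j))"
  \<comment> \<open>As \<open>x \<bullet> x = \<sigma>\<close> and
    \<open>yc \<bullet> x = 0\<close>, the mixed term sends \<open>x\<close> to \<open>- yc\<close>
    and the last term kills it: this is the kernel condition off \<open>S\<close>.\<close>
  define Z where "Z = (\<chi> i j. (if i \<in> S \<and> j \<in> S then P $ i $ j else 0)
    - (yc $ i * x $ j + x $ i * yc $ j) / \<sigma> + t * (yc $ i * yc $ j))"
  have \<sigma>: "0 < real \<sigma>" using assms(1) by simp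
  have \<eta>: "0 < \<eta>" using assms(6) by (simp add: \<eta>_def)
  have "S \<noteq> {}" using card assms(1) by auto
  have sq: "x $ i * x $ i = (if i \<in> S then 1 else 0)" "\<bar>x $ i\<bar> = (if i \<in> S then 1 else 0)"
    and x0: "i \<notin> S \<Longrightarrow> x $ i = 0" for i
    using x[rule_format, of i] by (auto simp: S supp_def)
  have xx: "x \<bullet> x = \<sigma>" by (simp add: inner_vec_def sq sum.If_cases card)
  have yx: "y \<bullet> x = - \<eta>"
  proof -
    have "(\<Sum>i\<in>S. y $ i * x $ i) = (\<Sum>i\<in>UNIV. y $ i * x $ i)"
      by (rule sum.mono_neutral_left) (use x0 in auto)
    then show ?thesis by (simp add: \<eta>_def Y11_star_def y_def S inner_vec_def)
  qed
  have yc_entry: "yc $ i = (if i \<in> S then 0 else y $ i)" for i by (simp add: yc_def yS_def)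
  have ycx: "yc \<bullet> x = 0" unfolding inner_vec_def by (intro sum.neutral ballI) (simp add: yc_entry x0)
  have ySx: "yS \<bullet> x = - \<eta>" using yx ycx by (simp add: yc_def inner_diff_left)
  have Gx: "(\<Sum>j\<in>S. G $ i $ j * x $ j) = (G *v x) $ i" for i
    unfolding matrix_vector_mult_def vec_lambda_beta
    by (rule sum.mono_neutral_left) (use x0 in auto)

  \<comment> \<open>The squared norm of \<open>e\<close> is \<open>\<sigma>\<close> times the
    squared tangent of the angle. Hence the bracket subtracted in \<open>Delta2\<close> becomes
    \<open>\<sigma> * t * c\<^sup>2\<close>.\<close>
  have ee: "e \<bullet> e = (real \<sigma>)\<^sup>2 * (yS \<bullet> yS) / \<eta>\<^sup>2 - \<sigma>"
    using \<eta> by (simp add: e_def inner_add_left inner_add_right xx ySx inner_commute[of x yS]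
        power2_eq_square field_simps)
  have "yS \<bullet> yS = (\<Sum>i\<in>S. (y $ i)\<^sup>2)"
    unfolding inner_vec_def by (rule sum.mono_neutral_cong_right) (auto simp: yS_def power2_eq_square)
  then have cos: "(cos (theta \<sigma> M b x))\<^sup>2 = \<eta>\<^sup>2 / (\<sigma> * (yS \<bullet> yS))"
    using cos_theta_squared[OF x, of \<sigma> M b] card by (simp add: S \<eta>_def y_def)
  have "yS \<noteq> 0" using ySx \<eta> by auto
  then have "0 < yS \<bullet> yS" by simp
  then have tan: "(1 - (cos (theta \<sigma> M b x))\<^sup>2) / (\<delta> * (cos (theta \<sigma> M b x))\<^sup>2)
      = (e \<bullet> e) / (\<delta> * \<sigma>)"
    unfolding cos ee using \<eta> \<sigma> \<delta> by (simp add: field_simps power2_eq_square)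
  have D1: "Delta1 M b x = m - c" by (simp add: Delta1_def m_def c_def S y_def)
  have D2: "Delta2 \<sigma> M b x \<delta> = m - \<sigma> * t * c\<^sup>2"
    unfolding Delta2_def tan unfolding S[symmetric] y_def[symmetric] \<eta>_def[symmetric]
      m_def[symmetric] c_def[symmetric] t_def
    using \<eta> \<sigma> \<delta> by (simp add: field_simps power2_eq_square)

  have K\<sigma>: "K * \<sigma> = \<Delta> + max c (\<sigma> * t * c\<^sup>2)" using \<sigma> by (simp add: K_def)
  \<comment> \<open>As \<open>1 / x $ i = x $ i\<close> on \<open>S\<close> and the smaller of the
    two deltas is \<open>m - max c (\<sigma> * t * c\<^sup>2)\<close>, this is exactly what the
    first condition provides.\<close>
  have q: "\<delta> - \<kappa> \<le> q i" if "i \<in> S" for i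
  proof -
    have "m \<le> - y $ i / x $ i" unfolding m_def by (rule Min_le) (use that in auto)
    also have "\<dots> = - y $ i * x $ i" using x[rule_format, of i] by auto
    finally have "m \<le> - y $ i * x $ i" .
    moreover have "\<bar>(G *v x) $ i * x $ i\<bar> \<le> g"
      using linf_on_upper[OF _ that, of "\<lambda>i. \<Sum>j\<in>S. G $ i $ j * x $ j"] that
      by (simp add: abs_mult sq Gx g_def)
    moreover have "\<kappa> - \<delta> - g + (m - max c (\<sigma> * t * c\<^sup>2)) \<ge> \<Delta>"
      using C1 unfolding D1 D2 by (simp add: \<kappa>_def g_def G_def min_def max_def split: if_splits)
    ultimately show ?thesis unfolding q_def K\<sigma> by linarith
  qed

  have t: "0 < t" using \<eta> \<delta> \<sigma> by (simp add: t_def add_pos_nonneg)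
  have c: "0 \<le> c" "\<And>i. \<bar>yc $ i\<bar> \<le> c"
    using linf_on_nonneg[of "- S" "\<lambda>i. y $ i"] linf_on_upper[of "- S" _ "\<lambda>i. y $ i"]
    by (auto simp: c_def yc_entry)
  have Kge: "\<Delta> / \<sigma> + c / \<sigma> \<le> K" "\<Delta> / \<sigma> + t * c\<^sup>2 \<le> K"
    using \<sigma> by (auto simp: K_def add_divide_distrib[symmetric] field_simps)
  have "0 < \<Delta> / \<sigma>" "0 \<le> c / \<sigma>" using c(1) \<Delta> \<sigma> by simp_all
  then have K: "0 < K" using Kge(1) by linarith

  have symP: "transpose P = P"
    using sym_entry[OF transpose_gram, of M]
    by (auto simp: P_def G_def transpose_def vec_eq_iff mult.commute)
  have Pmul: "v \<bullet> (P *v w) = v \<bullet> (G *v w) + (\<Sum>i\<in>UNIV. q i * (v $ i * w $ i)) + K * ((x \<bullet> v) * (x \<bullet> w))"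
    for v w
  proof -
    have "(P *v w) $ i = (G *v w) $ i + q i * w $ i + K * x $ i * (x \<bullet> w)" for i
      by (simp add: P_def matrix_vector_mult_def inner_vec_def distrib_right sum.distrib
          if_distrib[of "\<lambda>z. z * _"] sum_distrib_left mult.assoc cong: if_cong)
    then show ?thesis
      by (simp add: inner_vec_def[of v] inner_vec_def[of x v] distrib_left sum.distrib sum_distrib_left
          sum_distrib_right mult_ac)
  qed
  \<comment> \<open>The diagonal \<open>q\<close> gives \<open>\<delta> - \<kappa>\<close>, the
    Rayleigh bound for \<open>G\<close> gives back \<open>\<kappa>\<close>, and the \<open>K\<close>
    term is a square.\<close>
  have coercive: "\<delta> * (v \<bullet> v) \<le> v \<bullet> (P *v v)" if v: "\<And>i. i \<notin> S \<Longrightarrow> v $ i = 0" for v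
  proof -
    have "(\<delta> - \<kappa>) * (v $ i * v $ i) \<le> q i * (v $ i * v $ i)" for i
      using q[of i] v[of i] by (cases "i \<in> S") (auto intro: mult_right_mono)
    then have "(\<delta> - \<kappa>) * (v \<bullet> v) \<le> (\<Sum>i\<in>UNIV. q i * (v $ i * v $ i))"
      by (simp add: inner_vec_def sum_distrib_left sum_mono)
    moreover have "\<kappa> * (v \<bullet> v) \<le> v \<bullet> (G *v v)"
      unfolding \<kappa>_def G_def by (rule lambda_min_on_rayleigh[OF transpose_gram \<open>S \<noteq> {}\<close> v])
    moreover have "0 \<le> K * ((x \<bullet> v) * (x \<bullet> v))" using K by simp
    ultimately show ?thesis unfolding Pmul by (simp add: algebra_simps)
  qed
  have Px: "v \<bullet> (P *v x) = - (yS \<bullet> v)" if v: "\<And>i. i \<notin> S \<Longrightarrow> v $ i = 0" for v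
  proof -
    have "v $ i * (G *v x) $ i + q i * (v $ i * x $ i) + K * \<sigma> * (x $ i * v $ i) = - (yS $ i * v $ i)"
      for i
    proof (cases "i \<in> S")
      case True
      have "v $ i * (G *v x) $ i + q i * (v $ i * x $ i) + K * \<sigma> * (x $ i * v $ i)
          = v $ i * (G *v x) $ i * (1 - x $ i * x $ i) - y $ i * v $ i * (x $ i * x $ i)"
        by (simp add: q_def algebra_simps)
      then show ?thesis using True by (simp add: sq yS_def)
    qed (simp add: v)
    then have "(\<Sum>i\<in>UNIV. v $ i * (G *v x) $ i + q i * (v $ i * x $ i) + K * \<sigma> * (x $ i * v $ i))
        = (\<Sum>i\<in>UNIV. - (yS $ i * v $ i))" by (intro sum.cong refl)
    then show ?thesis
      unfolding Pmul xx by (simp add: inner_vec_def sum.distrib sum_distrib_left sum_negf mult_ac)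
  qed
  \<comment> \<open>Off \<open>S\<close> the vector \<open>h\<close> enters only through the number
    \<open>yc \<bullet> h\<close>, which reduces the form to that of
    \<open>schur_form_nonneg\<close>.\<close>
  have Zform: "h \<bullet> (Z *v h) = u \<bullet> (P *v u) - 2 * (yc \<bullet> h) * (x \<bullet> u) / \<sigma> + t * (yc \<bullet> h)\<^sup>2"
    if u: "u = (\<chi> i. if i \<in> S then h $ i else 0)" for h u
  proof -
    have xh: "x \<bullet> u = x \<bullet> h"
      unfolding inner_vec_def by (intro sum.cong refl) (auto simp: u x0)
    have "h \<bullet> (Z *v h) = (\<Sum>i\<in>UNIV. \<Sum>j\<in>UNIV. u $ i * (P $ i $ j * u $ j)
        - ((yc $ i * h $ i) * (x $ j * h $ j) + (x $ i * h $ i) * (yc $ j * h $ j)) / \<sigma>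
        + t * ((yc $ i * h $ i) * (yc $ j * h $ j)))"
      unfolding inner_vec_def matrix_vector_mult_def vec_lambda_beta sum_distrib_left inner_real_def
      by (intro sum.cong refl) (simp add: Z_def u algebra_simps add_divide_distrib)
    also have "\<dots> = u \<bullet> (P *v u) - ((yc \<bullet> h) * (x \<bullet> h) + (x \<bullet> h) * (yc \<bullet> h)) / \<sigma>
        + t * ((yc \<bullet> h) * (yc \<bullet> h))"
      unfolding inner_vec_def inner_real_def matrix_vector_mult_def vec_lambda_beta sum_product
      by (simp only: sum.distrib sum_subtractf sum_distrib_left sum_divide_distrib
          add_divide_distrib)
    finally show ?thesis by (simp add: xh power2_eq_square mult_ac)
  qed
  have psd: "0 \<le> v \<bullet> (bordered \<eta> y Z *v v)" for v
  proof -
    define h where "h = (\<chi> k. v $ Some k)"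
    define u where "u = (\<chi> i. if i \<in> S then h $ i else 0)"
    have "yS \<bullet> u = yS \<bullet> h"
      unfolding inner_vec_def by (intro sum.cong refl) (auto simp: u_def yS_def)
    then have yh: "y \<bullet> h = yS \<bullet> u + yc \<bullet> h" by (simp add: yc_def inner_diff_left)
    have "0 \<le> \<eta> * (v $ None)\<^sup>2 + 2 * (v $ None) * (yS \<bullet> u + yc \<bullet> h) + u \<bullet> (P *v u)
        - 2 * (yc \<bullet> h) * (x \<bullet> u) / \<sigma> + t * (yc \<bullet> h)\<^sup>2"
      unfolding t_def
      by (rule schur_form_nonneg[OF symP coercive Px x0 _ \<eta> ySx \<sigma> xx \<delta> e_def]) (auto simp: u_def)
    then show ?thesis
      unfolding bordered_quadratic h_def[symmetric] Zform[OF u_def] yh by simp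
  qed
  have Zx: "x \<bullet> (Z *v x) = \<eta>"
  proof -
    have "x = (\<chi> i. if i \<in> S then x $ i else 0)" by (auto simp: vec_eq_iff x0)
    from Zform[OF this] show ?thesis by (simp add: ycx Px x0 ySx)
  qed

  have cols: "norm (column k M) \<le> 1" for k using assms(7) by simp
  \<comment> \<open>The second condition (diagonal, where \<open>i = j\<close> lies off
    \<open>S\<close>) and the third (off-diagonal) bound the \<open>G\<close> part below
    \<open>\<Delta> / \<sigma>\<close>; the choice of \<open>K\<close> leaves
    \<open>K - \<Delta> / \<sigma>\<close> for \<open>Z\<close>.\<close>
  have off: "\<bar>Z $ i $ j - G $ i $ j - (if i = j then \<mu> else 0)\<bar> < K"
    if ij: "i \<notin> S \<or> j \<notin> S" for i j
  proof -
    have "\<bar>G $ i $ j + (if i = j then \<mu> else 0)\<bar> < \<Delta> / \<sigma>"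
    proof (cases "i = j")
      case True
      then have "\<bar>(gram M + \<mu> *\<^sub>R mat 1) $ i $ i\<bar> \<le> linf_on (- S) (\<lambda>i. (gram M + \<mu> *\<^sub>R mat 1) $ i $ i)"
        using ij by (intro linf_on_upper[of _ _ "\<lambda>i. (gram M + \<mu> *\<^sub>R mat 1) $ i $ i"]) auto
      with C2 True show ?thesis by (simp add: G_def mat_def)
    next
      case False
      with gram_off_diagonal_le_coherence[OF cols False] C3 show ?thesis by (simp add: G_def)
    qed
    moreover have "\<bar>Z $ i $ j\<bar> \<le> K - \<Delta> / \<sigma>"
    proof (cases "i \<in> S \<or> j \<in> S")
      case True
      then have "\<bar>Z $ i $ j\<bar> \<le> c / \<sigma>"
        using ij c(1) c(2)[of i] c(2)[of j] \<sigma> by (auto simp: Z_def yc_entry x0 abs_mult sq divide_right_mono)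
      then show ?thesis using Kge(1) by simp
    next
      case False
      have "\<bar>yc $ i\<bar> * \<bar>yc $ j\<bar> \<le> c * c" using c by (intro mult_mono) auto
      then have "t * (\<bar>yc $ i\<bar> * \<bar>yc $ j\<bar>) \<le> t * (c * c)" using t by simp
      moreover have "\<bar>Z $ i $ j\<bar> = t * (\<bar>yc $ i\<bar> * \<bar>yc $ j\<bar>)"
        using False t by (simp add: Z_def x0 abs_mult)
      ultimately show ?thesis using Kge(2) by (simp add: power2_eq_square)
    qed
    ultimately show ?thesis by linarith
  qed
  show ?thesis
  proof (rule sdp_recovers_certificate[where \<eta> = \<eta> and Z = Z and K = K and \<mu> = \<mu> and p = "\<lambda>i. q i - \<mu>"])
    \<comment> \<open>The upper bound on \<open>\<mu>\<close> is \<open>\<delta> - \<kappa>\<close>,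
      precisely the lower bound on \<open>q\<close>.\<close>
    fix i assume "i \<in> supp x"
    then show "0 \<le> q i - \<mu>" using q[of i] \<mu> by (simp add: S \<kappa>_def G_def)
  next
    fix i j assume "i \<in> supp x" "j \<in> supp x"
    then show "Z $ i $ j = gram M $ i $ j + (if i = j then \<mu> + (q i - \<mu>) else 0) + K * (x $ i * x $ j)"
      by (simp add: Z_def P_def yc_entry S G_def)
  next
    fix i j assume "i \<notin> supp x \<or> j \<notin> supp x"
    then show "\<bar>Z $ i $ j - gram M $ i $ j - (if i = j then \<mu> else 0)\<bar> < K"
      using off[of i j] by (simp add: S G_def)
  qed (use assms(1) x card \<eta> yx psd Zx K in \<open>simp_all add: S y_def\<close>)
qed

end
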